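(* Let $G$ and $H$ be graphs. Then $\mathcal{R}(G\cup H)\cong \mathcal{R}(G)\,\square\,\mathcal{R}(H)$, where $G\cup H$ is the disjoint union.
   Context: All graphs are finite, simple and undirected; $N(v)$ denotes the open neighbourhood of $v$. A set $S\subseteq V(G)$ is a dominating set if every vertex of $G$ is in $S$ or adjacent to a vertex of $S$; it is a minimal dominating set if no proper subset of $S$ is a dominating set. The reconfiguration graph $\mathcal{R}(G)$ has as vertex set the collection of all minimal dominating sets of $G$, and two minimal dominating sets $M_1,M_2$ are adjacent iff there is a vertex $v$ with either ($M_2\setminus M_1=\{v\}$ and $M_1\setminus M_2\subseteq N(v)$) or ($M_1\setminus M_2=\{v\}$ and $M_2\setminus M_1\subseteq N(v)$). The Cartesian product $A\,\square\,B$ has vertex set $V(A)\times V(B)$, with $(a,b)\sim(a',b')$ iff either $a=a'$ and $b\sim b'$ in $B$, or $b=b'$ and $a\sim a'$ in $A$. *)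

theory Defs
  imports "Graph_Theory.Graph_Theory"
begin

text \<open>
  A finite simple undirected graph is a \<^const>\<open>pair_graph\<close>: each undirected edge is represented
  by its two orientations. Isomorphism is \<^const>\<open>digraph_iso\<close>, applied through
  \<^const>\<open>with_proj\<close>; since tail and head are then the projections, such an isomorphism is
  the same thing as a bijection of the vertex sets preserving and reflecting adjacency.
\<close>

definition open_nbhd :: "'a pair_pre_digraph \<Rightarrow> 'a \<Rightarrow> 'a set" where
  "open_nbhd G v = {u. (v, u) \<in> parcs G}"

definition dominating_set :: "'a pair_pre_digraph \<Rightarrow> 'a set \<Rightarrow> bool" where
  "dominating_set G S \<longleftrightarrow>
     S \<subseteq> pverts G \<and> (\<forall>v \<in> pverts G. v \<in> S \<or> (\<exists>u \<in> S. (v, u) \<in> parcs G))"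

definition minimal_dominating_set :: "'a pair_pre_digraph \<Rightarrow> 'a set \<Rightarrow> bool" where
  "minimal_dominating_set G S \<longleftrightarrow>
     dominating_set G S \<and> (\<forall>T. T \<subset> S \<longrightarrow> \<not> dominating_set G T)"

definition reconf_adj :: "'a pair_pre_digraph \<Rightarrow> 'a set \<Rightarrow> 'a set \<Rightarrow> bool" where
  "reconf_adj G M1 M2 \<longleftrightarrow>
     (\<exists>v. (M2 - M1 = {v} \<and> M1 - M2 \<subseteq> open_nbhd G v) \<or>
          (M1 - M2 = {v} \<and> M2 - M1 \<subseteq> open_nbhd G v))"

definition reconf_graph :: "'a pair_pre_digraph \<Rightarrow> 'a set pair_pre_digraph" where
  "reconf_graph G =
     \<lparr> pverts = {M. minimal_dominating_set G M},
       parcs = {(M1, M2). minimal_dominating_set G M1 \<and> minimal_dominating_set G M2 \<and>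
                          reconf_adj G M1 M2} \<rparr>"

definition disjoint_union ::
    "'a pair_pre_digraph \<Rightarrow> 'b pair_pre_digraph \<Rightarrow> ('a + 'b) pair_pre_digraph" where
  "disjoint_union G H =
     \<lparr> pverts = pverts G <+> pverts H,
       parcs = map_prod Inl Inl ` parcs G \<union> map_prod Inr Inr ` parcs H \<rparr>"

definition cartesian_product ::
    "'a pair_pre_digraph \<Rightarrow> 'b pair_pre_digraph \<Rightarrow> ('a \<times> 'b) pair_pre_digraph" where
  "cartesian_product A B =
     \<lparr> pverts = pverts A \<times> pverts B,
       parcs = {((a, b), (a', b')).
                  (a = a' \<and> a \<in> pverts A \<and> (b, b') \<in> parcs B) \<or>
                  (b = b' \<and> b \<in> pverts B \<and> (a, a') \<in> parcs A)} \<rparr>"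

lemma pair_graphI:
  assumes "finite (pverts G)" "parcs G \<subseteq> pverts G \<times> pverts G" "sym (parcs G)" "irrefl (parcs G)"
  shows "pair_graph G"
proof -
  have "finite (parcs G)"
    using assms(1,2) finite_subset by blast
  then show ?thesis
    using assms by unfold_locales (auto simp: symmetric_def irrefl_def)
qed

lemma pair_graphD:
  assumes "pair_graph G"
  shows "finite (pverts G)" "parcs G \<subseteq> pverts G \<times> pverts G" "sym (parcs G)" "irrefl (parcs G)"
proof -
  interpret pair_graph G by fact
  show "finite (pverts G)" by (rule pair_finite_verts)
  show "parcs G \<subseteq> pverts G \<times> pverts G" by (auto dest: in_arcsD1 in_arcsD2)
  show "sym (parcs G)" using pair_sym_arcs by (simp add: symmetric_def)
  show "irrefl (parcs G)" by (auto simp: irrefl_def dest: no_loops')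
qed

lemma pair_graph_reconf_graph:
  assumes "pair_graph G"
  shows "pair_graph (reconf_graph G)"
proof (rule pair_graphI)
  have "pverts (reconf_graph G) \<subseteq> Pow (pverts G)"
    by (auto simp: reconf_graph_def minimal_dominating_set_def dominating_set_def)
  then show "finite (pverts (reconf_graph G))"
    using pair_graphD(1)[OF assms] by (simp add: finite_subset)
qed (auto simp: reconf_graph_def reconf_adj_def irrefl_def intro!: symI)

lemma pair_graph_disjoint_union:
  assumes "pair_graph G" "pair_graph H"
  shows "pair_graph (disjoint_union G H)"
  using pair_graphD[OF assms(1)] pair_graphD[OF assms(2)]
  by (intro pair_graphI) (auto simp: disjoint_union_def irrefl_def intro!: symI dest: symD)

lemma pair_graph_cartesian_product:
  assumes "pair_graph A" "pair_graph B"
  shows "pair_graph (cartesian_product A B)"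
  using pair_graphD[OF assms(1)] pair_graphD[OF assms(2)]
  by (intro pair_graphI) (auto simp: cartesian_product_def irrefl_def intro!: symI dest: symD)

end

theory Submission
  imports Defs
begin

text \<open>
  Restricting a vertex set of the disjoint union to the two components is the isomorphism.
  Minimal domination is decided on each component separately. In a reconfiguration step
  one of the two differences is a singleton {v} and the other lies in N(v), hence both lie in the
  component of v and the restriction to the other component stays fixed.
\<close>

text \<open>Every set over a sum type thus has the form \<open>A <+> B\<close>, so facts about the
  union may be stated for such sets only.\<close>

lemma Plus_vimage: "Inl -` S <+> Inr -` S = S"
proof (rule set_eqI)
  show "x \<in> Inl -` S <+> Inr -` S \<longleftrightarrow> x \<in> S" for x
    by (cases x) auto
qed

lemma vimage_Plus: "Inl -` (A <+> B) = A" "Inr -` (A <+> B) = B"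
  by auto

lemma Plus_subset_Plus_iff: "A <+> B \<subseteq> A' <+> B' \<longleftrightarrow> A \<subseteq> A' \<and> B \<subseteq> B'"
  by (auto simp: Plus_def)

lemma Plus_eq_Plus_iff: "A <+> B = A' <+> B' \<longleftrightarrow> A = A' \<and> B = B'"
  by (auto simp: set_eq_subset Plus_subset_Plus_iff)

lemma Plus_diff_Plus: "(A <+> B) - (A' <+> B') = (A - A') <+> (B - B')"
  by (auto simp: Plus_def)

lemma Plus_eq_singleton_Inl_iff: "A <+> B = {Inl v} \<longleftrightarrow> A = {v} \<and> B = {}"
  using Plus_eq_Plus_iff[of A B "{v}" "{}"] by (simp add: Plus_def)

lemma Plus_eq_singleton_Inr_iff: "A <+> B = {Inr v} \<longleftrightarrow> A = {} \<and> B = {v}"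
  using Plus_eq_Plus_iff[of A B "{}" "{v}"] by (simp add: Plus_def)

lemma open_nbhd_disjoint_union:
  "open_nbhd (disjoint_union G H) (Inl v) = open_nbhd G v <+> {}"
  "open_nbhd (disjoint_union G H) (Inr w) = {} <+> open_nbhd H w"
  by (auto simp: open_nbhd_def disjoint_union_def)

text \<open>No arc joins the two components, so a vertex can only be dominated from its own
  side.\<close>

lemma dominating_set_disjoint_union:
  "dominating_set (disjoint_union G H) (A <+> B) \<longleftrightarrow> dominating_set G A \<and> dominating_set H B"
proof -
  have "(\<forall>v \<in> pverts G <+> pverts H. P v) \<longleftrightarrow>
        (\<forall>v \<in> pverts G. P (Inl v)) \<and> (\<forall>v \<in> pverts H. P (Inr v))" for P
    by (auto simp: Plus_def)
  moreover have "(\<exists>u \<in> A <+> B. P u) \<longleftrightarrow> (\<exists>u \<in> A. P (Inl u)) \<or> (\<exists>u \<in> B. P (Inr u))" for P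
    by (auto simp: Plus_def)
  moreover have "(Inl v, Inl u) \<in> parcs (disjoint_union G H) \<longleftrightarrow> (v, u) \<in> parcs G"
    "(Inr v', Inr u') \<in> parcs (disjoint_union G H) \<longleftrightarrow> (v', u') \<in> parcs H"
    "(Inl v, Inr u') \<notin> parcs (disjoint_union G H)"
    "(Inr v', Inl u) \<notin> parcs (disjoint_union G H)" for u v u' v'
    by (auto simp: disjoint_union_def)
  moreover have "pverts (disjoint_union G H) = pverts G <+> pverts H"
    by (simp add: disjoint_union_def)
  ultimately show ?thesis
    unfolding dominating_set_def by (auto simp: Plus_subset_Plus_iff)
qed

text \<open>A proper subset of \<open>A <+> B\<close> is proper in at least one component.
  Conversely, a smaller dominating set in one component, joined with the unchanged other one,
  dominates the union.\<close>

lemma minimal_dominating_set_disjoint_union: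
  "minimal_dominating_set (disjoint_union G H) (A <+> B) \<longleftrightarrow>
     minimal_dominating_set G A \<and> minimal_dominating_set H B"
proof -
  have "(\<forall>T. P T) \<longleftrightarrow> (\<forall>A' B'. P (A' <+> B'))" for P :: "('a + 'b) set \<Rightarrow> bool"
    by (metis Plus_vimage)
  then show ?thesis
    unfolding minimal_dominating_set_def psubset_eq
    by (simp add: dominating_set_disjoint_union Plus_subset_Plus_iff Plus_eq_Plus_iff) blast
qed

text \<open>If the pivot is \<open>Inl v\<close>, both the singleton and its neighbourhood have an
  empty right part. Hence \<open>B - B'\<close> and \<open>B' - B\<close> are both empty, which
  gives \<open>B = B'\<close>. The case \<open>Inr w\<close> is symmetric.\<close>

lemma reconf_adj_disjoint_union:
  "reconf_adj (disjoint_union G H) (A <+> B) (A' <+> B') \<longleftrightarrow>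
     (A = A' \<and> reconf_adj H B B') \<or> (B = B' \<and> reconf_adj G A A')"
proof -
  have "(\<exists>v. P v) \<longleftrightarrow> (\<exists>v. P (Inl v)) \<or> (\<exists>w. P (Inr w))" for P :: "'a + 'b \<Rightarrow> bool"
    by (metis sumE)
  then show ?thesis
    unfolding reconf_adj_def
    by (simp add: Plus_diff_Plus Plus_eq_singleton_Inl_iff Plus_eq_singleton_Inr_iff
        open_nbhd_disjoint_union Plus_subset_Plus_iff) blast
qed

text \<open>Since arcs are pairs with the projections as tail and head, the vertex map
  \<open>f\<close> already determines the arc map \<open>map_prod f f\<close>.\<close>

lemma digraph_iso_with_projI:
  assumes "wf_digraph (with_proj G)"
    and bij: "bij_betw f (pverts G) (pverts H)"
    and parcs: "parcs H = map_prod f f ` parcs G"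
  shows "digraph_iso (with_proj G) (with_proj H)"
proof -
  interpret wf_digraph "with_proj G" by fact
  let ?h = "\<lparr>iso_verts = f, iso_arcs = map_prod f f, iso_head = snd, iso_tail = fst\<rparr>"
  have inj: "inj_on f (pverts G)" and img: "f ` pverts G = pverts H"
    using bij by (auto simp: bij_betw_def)
  \<comment> \<open>\<open>f\<close> is injective only on \<open>pverts G\<close>, so the arcs must
    have their ends there for \<open>map_prod f f\<close> to be injective on them.\<close>
  have "parcs G \<subseteq> pverts G \<times> pverts G"
    using wellformed by auto
  then have "inj_on (map_prod f f) (parcs G)"
    using inj by (blast intro: inj_on_subset map_prod_inj_on)
  then have "digraph_isomorphism ?h"
    using inj wf_digraph_axioms by (auto simp: digraph_isomorphism_def)
  moreover have "with_proj H = app_iso ?h (with_proj G)"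
    using img parcs by (simp add: app_iso_def with_proj_def)
  ultimately show ?thesis
    unfolding digraph_iso_def by blast
qed

theorem theorem2:
  fixes G :: "'a pair_pre_digraph" and H :: "'b pair_pre_digraph"
  assumes "pair_graph G" and "pair_graph H"
  shows "digraph_iso (with_proj (reconf_graph (disjoint_union G H)))
                     (with_proj (cartesian_product (reconf_graph G) (reconf_graph H)))"
proof (rule digraph_iso_with_projI)
  let ?R = "reconf_graph (disjoint_union G H)"
  let ?C = "cartesian_product (reconf_graph G) (reconf_graph H)"
  let ?f = "\<lambda>S :: ('a + 'b) set. (Inl -` S, Inr -` S)"
  interpret R: pair_graph ?R
    by (intro pair_graph_reconf_graph pair_graph_disjoint_union assms)
  show "wf_digraph (with_proj ?R)"
    by (rule R.wf_digraph)
  have verts: "A <+> B \<in> pverts ?R \<longleftrightarrow> (A, B) \<in> pverts ?C" for A B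
    by (simp add: reconf_graph_def cartesian_product_def minimal_dominating_set_disjoint_union)
  have arcs: "(A <+> B, A' <+> B') \<in> parcs ?R \<longleftrightarrow> ((A, B), (A', B')) \<in> parcs ?C" for A B A' B'
    by (auto simp: reconf_graph_def cartesian_product_def minimal_dominating_set_disjoint_union
        reconf_adj_disjoint_union)
  \<comment> \<open>Any \<open>S\<close> is the sum of its two restrictions, which carries
    \<open>verts\<close> over to arbitrary sets.\<close>
  have verts_f: "S \<in> pverts ?R \<longleftrightarrow> ?f S \<in> pverts ?C" for S
    using verts[of "Inl -` S" "Inr -` S"] by (simp add: Plus_vimage)
  have arcs_f: "(S, T) \<in> parcs ?R \<longleftrightarrow> (?f S, ?f T) \<in> parcs ?C" for S T
    using arcs[of "Inl -` S" "Inr -` S" "Inl -` T" "Inr -` T"] by (simp add: Plus_vimage)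
  show "bij_betw ?f (pverts ?R) (pverts ?C)"
    by (rule bij_betw_byWitness[where f' = "\<lambda>(A, B). A <+> B"])
      (auto simp: Plus_vimage vimage_Plus verts verts_f)
  show "parcs ?C = map_prod ?f ?f ` parcs ?R"
  proof (intro equalityI subsetI)
    fix e assume e: "e \<in> parcs ?C"
    obtain A B A' B' where [simp]: "e = ((A, B), (A', B'))"
      by (metis surj_pair)
    \<comment> \<open>Gluing the components with \<open><+>\<close> inverts \<open>?f\<close>, so
      this arc is the required preimage of \<open>e\<close>.\<close>
    have "(A <+> B, A' <+> B') \<in> parcs ?R"
      using e by (simp add: arcs)
    then show "e \<in> map_prod ?f ?f ` parcs ?R"
      by (rule rev_image_eqI) (simp add: vimage_Plus)
  next
    fix e assume "e \<in> map_prod ?f ?f ` parcs ?R"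
    then show "e \<in> parcs ?C"
      using arcs_f by auto
  qed
qed

end
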